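(* Consider the contract game with compensation contract $\pi_i(y_1,\dots,y_n)=\delta_i-\gamma_i(\hat{x}-y_i)^2$. Suppose that, for all $i\in\{1,\dots,n\}$, $$\alpha_i\gamma_i\frac{(n-1)^2}{n^2}\eta'_i(0)+f'_i(0)<0\quad\text{and}\quad \alpha_i\gamma_i\frac{(n-1)^2}{n^2}\eta''_i(a)+f''_i(a)\geq 0\ \text{ for all }a\in\mathbb{R}_{\geq 0}.$$ Define $$\mathcal{A}_i=\left\{a_i\in\mathbb{R}_{\geq 0}\ \middle|\ \alpha_i\gamma_i\left(\frac{n-1}{n}\right)^2\eta'_i(a_i)+f'_i(a_i)=0\right\}.$$ Then an action tuple $(a_i^* )_{i=1}^n\in\mathbb{R}_{\geq 0}^n$ is a contract equilibrium if and only if $(a_i^* )_{i=1}^n\in\prod_{i=1}^n\mathcal{A}_i$.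
   Context: There are $n$ sensors. Sensor $i$ chooses an effort $a_i\in\mathbb{R}_{\geq 0}$ and reports $y_i=x+w_i$, where $x\in\mathbb{R}$ is the unknown quantity being measured and, for each action tuple $(a_1,\dots,a_n)$, $w_i$ is a zero-mean random variable with variance $\mathbb{E}\{w_i^2\}=\eta_i(a_i)$, and $\mathbb{E}\{w_iw_j\}=0$ for $i\neq j$. Standing assumptions: $\eta_i:\mathbb{R}_{\geq 0}\to\mathbb{R}_{\geq 0}$ is twice continuously differentiable and strictly decreasing; $f_i:\mathbb{R}_{\geq 0}\to\mathbb{R}$ (cost of effort) is twice continuously differentiable and strictly increasing. Primes denote derivatives (one-sided at $0$). The central planner uses the averaging estimate $\hat{x}=\frac1n(y_1+\dots+y_n)$ and pays sensor $i$ the compensation $p_i=\pi_i(y_1,\dots,y_n)=\delta_i-\gamma_i(\hat{x}-y_i)^2$, with constants $\gamma_i,\delta_i\in\mathbb{R}_{\geq 0}$. With $\alpha_i\in\mathbb{R}_{\geq 0}$ the value-of-compensation, the utility of sensor $i$ is $\bar{C}_i(a_i,a_{-i})=\alpha_i\mathbb{E}\{p_i\}-f_i(a_i)$, where $a_{-i}=(a_j)_{j\neq i}$. An action tuple $(a_i^* )_{i=1}^n\in\mathbb{R}_{\geq 0}^n$ is a contract equilibrium if $a_i^*\in\operatorname*{arg\,max}_{a_i\in\mathbb{R}_{\geq 0}}\bar{C}_i(a_i,a_{-i}^* )$ for all $i\in\{1,\dots,n\}$. *)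

theory Defs
  imports "HOL-Probability.Probability"
begin

text \<open>
  Sensors are the elements of a finite type \<open>'n\<close>, so \<open>n = CARD('n)\<close>.  Tuples indexed by sensors are
  functions on \<open>'n\<close>.
\<close>

text \<open>\<open>g1\<close> and \<open>g2\<close> are the first and second derivatives of \<open>g\<close> on \<open>[0, \<infinity>)\<close>; derivatives within
  \<open>{0..}\<close> are one-sided at \<open>0\<close>.\<close>

definition C2_on_nonneg :: "(real \<Rightarrow> real) \<Rightarrow> (real \<Rightarrow> real) \<Rightarrow> (real \<Rightarrow> real) \<Rightarrow> bool" where
  "C2_on_nonneg g g1 g2 \<longleftrightarrow>
     (\<forall>t\<in>{0..}. (g has_real_derivative g1 t) (at t within {0..})) \<and>
     (\<forall>t\<in>{0..}. (g1 has_real_derivative g2 t) (at t within {0..})) \<and>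
     continuous_on {0..} g2"

definition average :: "('n::finite \<Rightarrow> real) \<Rightarrow> real" where
  "average y = (\<Sum>j\<in>UNIV. y j) / real CARD('n)"

definition quadratic_contract ::
    "('n::finite \<Rightarrow> real) \<Rightarrow> ('n \<Rightarrow> real) \<Rightarrow> 'n \<Rightarrow> ('n \<Rightarrow> real) \<Rightarrow> real" where
  "quadratic_contract \<gamma> \<delta> i y = \<delta> i - \<gamma> i * (average y - y i)\<^sup>2"

text \<open>The noise \<open>w a i\<close> of sensor \<open>i\<close> is a random variable on \<open>M\<close> that may depend on the whole action
  tuple \<open>a\<close>.  Square integrability is stated explicitly because the Bochner integral of a
  non-integrable function is \<open>0\<close>; it makes \<open>w a i\<close> and \<open>w a i * w a j\<close> integrable.\<close>

definition noise_model ::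
    "'s measure \<Rightarrow> ('n \<Rightarrow> real \<Rightarrow> real) \<Rightarrow> (('n \<Rightarrow> real) \<Rightarrow> 'n \<Rightarrow> 's \<Rightarrow> real) \<Rightarrow> bool" where
  "noise_model M \<eta> w \<longleftrightarrow>
     prob_space M \<and>
     (\<forall>a. (\<forall>i. 0 \<le> a i) \<longrightarrow>
       (\<forall>i. w a i \<in> borel_measurable M \<and>
            integrable M (\<lambda>s. (w a i s)\<^sup>2) \<and>
            (\<integral>s. w a i s \<partial>M) = 0 \<and>
            (\<integral>s. (w a i s)\<^sup>2 \<partial>M) = \<eta> i (a i)) \<and>
       (\<forall>i j. i \<noteq> j \<longrightarrow> (\<integral>s. w a i s * w a j s \<partial>M) = 0))"

definition report ::
    "real \<Rightarrow> (('n \<Rightarrow> real) \<Rightarrow> 'n \<Rightarrow> 's \<Rightarrow> real) \<Rightarrow> ('n \<Rightarrow> real) \<Rightarrow> 's \<Rightarrow> 'n \<Rightarrow> real" where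
  "report x w a s i = x + w a i s"

definition utility ::
    "'s measure \<Rightarrow> real \<Rightarrow> (('n \<Rightarrow> real) \<Rightarrow> 'n \<Rightarrow> 's \<Rightarrow> real) \<Rightarrow> ('n \<Rightarrow> real) \<Rightarrow>
     ('n \<Rightarrow> ('n \<Rightarrow> real) \<Rightarrow> real) \<Rightarrow> ('n \<Rightarrow> real \<Rightarrow> real) \<Rightarrow> 'n \<Rightarrow> ('n \<Rightarrow> real) \<Rightarrow> real" where
  "utility M x w \<alpha> \<pi> f i a = \<alpha> i * (\<integral>s. \<pi> i (report x w a s) \<partial>M) - f i (a i)"

definition contract_equilibrium ::
    "('n \<Rightarrow> ('n \<Rightarrow> real) \<Rightarrow> real) \<Rightarrow> ('n \<Rightarrow> real) \<Rightarrow> bool" where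
  "contract_equilibrium U a \<longleftrightarrow> (\<forall>i. is_arg_max (\<lambda>b. U i (a(i := b))) (\<lambda>b. 0 \<le> b) (a i))"

definition stationary_efforts ::
    "('n::finite \<Rightarrow> real) \<Rightarrow> ('n \<Rightarrow> real) \<Rightarrow> ('n \<Rightarrow> real \<Rightarrow> real) \<Rightarrow> ('n \<Rightarrow> real \<Rightarrow> real) \<Rightarrow> 'n \<Rightarrow> real set"
  where
  "stationary_efforts \<alpha> \<gamma> \<eta>' f' i =
     {t. 0 \<le> t \<and>
         \<alpha> i * \<gamma> i * ((real CARD('n) - 1) / real CARD('n))\<^sup>2 * \<eta>' i t + f' i t = 0}"

end

theory Submission
  imports Defs
begin

text \<open>
  The residual \<open>average y - y i\<close> does not involve the measured quantity: it is a linear combination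
  of the noises, in which sensor \<open>i\<close> has the coefficient \<open>1/n - 1\<close> and every other sensor has
  \<open>1/n\<close>.  The noises are uncorrelated, so the expected squared residual is
  \<open>((n - 1)/n)\<^sup>2 * \<eta> i (a i)\<close> plus a term that depends on the efforts of the others only
  (\<open>expected_squared_residual\<close>).  Against fixed efforts of the others, sensor \<open>i\<close> therefore
  maximises a constant minus \<open>g b = k * \<eta> i b + f i b\<close>, where
  \<open>k = \<alpha> i * \<gamma> i * ((n - 1)/n)\<^sup>2\<close>; the actions of the others move its utility but not its best
  response, and the game splits into \<open>n\<close> separate minimisations over the half-line.

  The second-order condition says that \<open>g\<close> is convex, which makes every stationary point a global
  minimum.  The first-order condition says that \<open>g\<close> falls at \<open>0\<close>.  This excludes a minimum at the
  boundary, the only place where a minimiser could fail to be stationary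
  (\<open>half_line_minimizer_iff_stationary\<close>).
\<close>

lemma mean_value_half_line:
  fixes g g' :: "real \<Rightarrow> real"
  assumes deriv: "\<And>t. 0 \<le> t \<Longrightarrow> (g has_real_derivative g' t) (at t within {0..})"
    and "0 \<le> u" "u \<le> v"
  obtains z where "u \<le> z" "z \<le> v" "g v - g u = g' z * (v - u)"
proof -
  have "\<exists>z\<in>{u..v}. g v - g u = (*) (g' z) (v - u)"
  proof (rule mvt_very_simple)
    show "(g has_derivative (*) (g' t)) (at t within {u..v})" if "u \<le> t" "t \<le> v" for t
      using has_field_derivative_subset[OF deriv, of t "{u..v}"] that assms(2)
      by (auto simp: has_field_derivative_def)
  qed fact
  with that show thesis by auto
qed

text \<open>Sufficiency is convexity.  For necessity, an interior minimiser is stationary, and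
  \<open>g' 0 < 0\<close> provides a point to the right of \<open>0\<close> with a smaller value.\<close>

lemma half_line_minimizer_iff_stationary:
  fixes g g' g'' :: "real \<Rightarrow> real"
  assumes deriv: "\<And>t. 0 \<le> t \<Longrightarrow> (g has_real_derivative g' t) (at t within {0..})"
    and deriv2: "\<And>t. 0 \<le> t \<Longrightarrow> (g' has_real_derivative g'' t) (at t within {0..})"
    and convex: "\<And>t. 0 \<le> t \<Longrightarrow> 0 \<le> g'' t"
    and descent: "g' 0 < 0"
    and "0 \<le> t"
  shows "(\<forall>b\<ge>0. g t \<le> g b) \<longleftrightarrow> g' t = 0"
proof
  assume min: "\<forall>b\<ge>0. g t \<le> g b"
  have "t \<noteq> 0"
  proof
    assume "t = 0"
    obtain d where "0 < d" and "\<And>h. h > 0 \<Longrightarrow> 0 + h \<in> {0..} \<Longrightarrow> h < d \<Longrightarrow> g (0 + h) < g 0"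
      using has_real_derivative_neg_dec_right[OF deriv[OF order_refl] descent] by blast
    from this(1) this(2)[of "d / 2"] have "g (d / 2) < g 0" by simp
    with min \<open>t = 0\<close> \<open>0 < d\<close> show False by (auto dest!: spec[of _ "d / 2"])
  qed
  with \<open>0 \<le> t\<close> have "0 < t" by simp
  have "(g has_real_derivative g' t) (at t)"
    using deriv[OF \<open>0 \<le> t\<close>] at_within_interior[of t "{0..}"] \<open>0 < t\<close> by simp
  then show "g' t = 0"
    by (rule DERIV_local_min[OF _ \<open>0 < t\<close>]) (use min in auto)
next
  assume stationary: "g' t = 0"
  have mono: "g' u \<le> g' v" if "0 \<le> u" "u \<le> v" for u v
  proof -
    obtain z where "u \<le> z" "g' v - g' u = g'' z * (v - u)"
      using mean_value_half_line[OF deriv2 \<open>0 \<le> u\<close> \<open>u \<le> v\<close>] .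
    with convex[of z] that show ?thesis
      by (smt (verit) mult_nonneg_nonneg)
  qed
  show "\<forall>b\<ge>0. g t \<le> g b"
  proof (intro allI impI)
    fix b :: real
    assume "0 \<le> b"
    show "g t \<le> g b"
    proof (cases "t \<le> b")
      case True
      obtain z where "t \<le> z" "g b - g t = g' z * (b - t)"
        using mean_value_half_line[OF deriv \<open>0 \<le> t\<close> True] .
      with mono[of t z] stationary \<open>0 \<le> t\<close> True show ?thesis
        by (smt (verit) mult_nonneg_nonneg)
    next
      case False
      then obtain z where "b \<le> z" "z \<le> t" "g t - g b = g' z * (t - b)"
        using mean_value_half_line[OF deriv \<open>0 \<le> b\<close>, of t] by auto
      with mono[of z t] stationary \<open>0 \<le> b\<close> False show ?thesis
        by (smt (verit) mult_nonpos_nonneg)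
    qed
  qed
qed

lemma integrable_mult_of_square_integrable:
  fixes f g :: "'s \<Rightarrow> real"
  assumes [measurable]: "f \<in> borel_measurable M" "g \<in> borel_measurable M"
    and "integrable M (\<lambda>s. (f s)\<^sup>2)" "integrable M (\<lambda>s. (g s)\<^sup>2)"
  shows "integrable M (\<lambda>s. f s * g s)"
proof (rule Bochner_Integration.integrable_bound)
  show "integrable M (\<lambda>s. (f s)\<^sup>2 + (g s)\<^sup>2)"
    using assms by simp
  have "\<bar>u * v\<bar> \<le> u\<^sup>2 + v\<^sup>2" for u v :: real
    using sum_squares_bound[of "\<bar>u\<bar>" "\<bar>v\<bar>"] mult_nonneg_nonneg[of "\<bar>u\<bar>" "\<bar>v\<bar>"]
    unfolding abs_mult power2_abs by linarith
  then show "AE s in M. norm (f s * g s) \<le> norm ((f s)\<^sup>2 + (g s)\<^sup>2)"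
    by simp
qed simp

lemma
  fixes W :: "'n::finite \<Rightarrow> 's \<Rightarrow> real" and c :: "'n \<Rightarrow> real"
  assumes meas: "\<And>j. W j \<in> borel_measurable M"
    and sq: "\<And>j. integrable M (\<lambda>s. (W j s)\<^sup>2)"
    and uncorrelated: "\<And>j k. j \<noteq> k \<Longrightarrow> (\<integral>s. W j s * W k s \<partial>M) = 0"
  shows integrable_square_linear_combination: "integrable M (\<lambda>s. (\<Sum>j\<in>UNIV. c j * W j s)\<^sup>2)"
    and second_moment_uncorrelated_linear_combination:
      "(\<integral>s. (\<Sum>j\<in>UNIV. c j * W j s)\<^sup>2 \<partial>M) = (\<Sum>j\<in>UNIV. (c j)\<^sup>2 * (\<integral>s. (W j s)\<^sup>2 \<partial>M))"
proof -
  have expand: "(\<Sum>j\<in>UNIV. c j * W j s)\<^sup>2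
      = (\<Sum>j\<in>UNIV. \<Sum>k\<in>UNIV. c j * c k * (W j s * W k s))" for s
    by (simp add: power2_eq_square sum_product mult_ac)
  have int: "integrable M (\<lambda>s. W j s * W k s)" for j k
    by (intro integrable_mult_of_square_integrable meas sq)
  show "integrable M (\<lambda>s. (\<Sum>j\<in>UNIV. c j * W j s)\<^sup>2)"
    unfolding expand using int by simp
  have "(\<integral>s. (\<Sum>j\<in>UNIV. c j * W j s)\<^sup>2 \<partial>M)
      = (\<Sum>j\<in>UNIV. \<Sum>k\<in>UNIV. c j * c k * (\<integral>s. W j s * W k s \<partial>M))"
    unfolding expand using int by simp
  also have "\<dots> = (\<Sum>j\<in>UNIV. \<Sum>k\<in>UNIV. if k = j then (c j)\<^sup>2 * (\<integral>s. (W j s)\<^sup>2 \<partial>M) else 0)"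
    by (intro sum.cong refl) (auto simp: power2_eq_square uncorrelated)
  finally show "(\<integral>s. (\<Sum>j\<in>UNIV. c j * W j s)\<^sup>2 \<partial>M) = (\<Sum>j\<in>UNIV. (c j)\<^sup>2 * (\<integral>s. (W j s)\<^sup>2 \<partial>M))"
    by simp
qed

lemma residual_eq_noise_combination:
  fixes w :: "('n::finite \<Rightarrow> real) \<Rightarrow> 'n \<Rightarrow> 's \<Rightarrow> real"
  shows "average (report x w a s) - report x w a s i
    = (\<Sum>j\<in>UNIV. (1 / real CARD('n) - (if j = i then 1 else 0)) * w a j s)"
proof -
  have "(\<Sum>j\<in>UNIV. (1 / real CARD('n) - (if j = i then 1 else 0)) * w a j s)
      = (\<Sum>j\<in>UNIV. w a j s / real CARD('n) - (if j = i then w a j s else 0))"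
    by (intro sum.cong) (auto simp: algebra_simps)
  then show ?thesis
    by (simp add: average_def report_def sum.distrib sum_subtractf sum_divide_distrib add_divide_distrib)
qed

lemma
  fixes w :: "('n::finite \<Rightarrow> real) \<Rightarrow> 'n \<Rightarrow> 's \<Rightarrow> real"
  assumes noise: "noise_model M \<eta> w" and a: "\<And>j. 0 \<le> a j"
  shows integrable_squared_residual:
      "integrable M (\<lambda>s. (average (report x w a s) - report x w a s i)\<^sup>2)"
    and expected_squared_residual:
      "(\<integral>s. (average (report x w a s) - report x w a s i)\<^sup>2 \<partial>M)
        = ((real CARD('n) - 1) / real CARD('n))\<^sup>2 * \<eta> i (a i)
          + (\<Sum>j\<in>UNIV - {i}. \<eta> j (a j)) / (real CARD('n))\<^sup>2"
proof -
  let ?c = "\<lambda>j. 1 / real CARD('n) - (if j = i then 1 else 0)"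
  have w: "w a j \<in> borel_measurable M" "integrable M (\<lambda>s. (w a j s)\<^sup>2)"
    "(\<integral>s. (w a j s)\<^sup>2 \<partial>M) = \<eta> j (a j)" "j \<noteq> k \<Longrightarrow> (\<integral>s. w a j s * w a k s \<partial>M) = 0" for j k
    using noise a by (auto simp: noise_model_def)
  show "integrable M (\<lambda>s. (average (report x w a s) - report x w a s i)\<^sup>2)"
    unfolding residual_eq_noise_combination by (rule integrable_square_linear_combination[OF w(1,2,4)])
  have "(\<integral>s. (average (report x w a s) - report x w a s i)\<^sup>2 \<partial>M)
      = (\<Sum>j\<in>UNIV. (?c j)\<^sup>2 * \<eta> j (a j))"
    unfolding residual_eq_noise_combination
    by (subst second_moment_uncorrelated_linear_combination[OF w(1,2,4)]) (simp_all add: w(3))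
  also have "\<dots> = (?c i)\<^sup>2 * \<eta> i (a i) + (\<Sum>j\<in>UNIV - {i}. (?c j)\<^sup>2 * \<eta> j (a j))"
    by (rule sum.remove) auto
  also have "(\<Sum>j\<in>UNIV - {i}. (?c j)\<^sup>2 * \<eta> j (a j)) = (\<Sum>j\<in>UNIV - {i}. \<eta> j (a j)) / (real CARD('n))\<^sup>2"
    unfolding sum_divide_distrib by (intro sum.cong) (auto simp: power_divide)
  also have "(?c i)\<^sup>2 = ((real CARD('n) - 1) / real CARD('n))\<^sup>2"
    by (simp add: diff_divide_distrib power2_commute)
  finally show "(\<integral>s. (average (report x w a s) - report x w a s i)\<^sup>2 \<partial>M)
      = ((real CARD('n) - 1) / real CARD('n))\<^sup>2 * \<eta> i (a i)
        + (\<Sum>j\<in>UNIV - {i}. \<eta> j (a j)) / (real CARD('n))\<^sup>2" .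
qed

text \<open>Here \<open>K\<close> collects the offset \<open>\<delta> i\<close> and the noise of the other sensors; it is independent of
  \<open>b\<close> because the variance of the noise of a sensor \<open>j \<noteq> i\<close> depends on \<open>a j\<close> alone.\<close>

lemma utility_of_deviation:
  fixes w :: "('n::finite \<Rightarrow> real) \<Rightarrow> 'n \<Rightarrow> 's \<Rightarrow> real"
  assumes noise: "noise_model M \<eta> w" and a: "\<And>j. 0 \<le> a j"
  obtains K where "\<And>b. 0 \<le> b \<Longrightarrow> utility M x w \<alpha> (quadratic_contract \<gamma> \<delta>) f i (a(i := b))
    = K - (\<alpha> i * \<gamma> i * ((real CARD('n) - 1) / real CARD('n))\<^sup>2 * \<eta> i b + f i b)"
proof
  fix b :: real
  assume "0 \<le> b"
  interpret prob_space M
    using noise by (simp add: noise_model_def)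
  let ?a = "a(i := b)"
  have pos: "0 \<le> ?a j" for j
    using a \<open>0 \<le> b\<close> by simp
  have "(\<Sum>j\<in>UNIV - {i}. \<eta> j (?a j)) = (\<Sum>j\<in>UNIV - {i}. \<eta> j (a j))"
    by (intro sum.cong) auto
  then have payment: "(\<integral>s. quadratic_contract \<gamma> \<delta> i (report x w ?a s) \<partial>M)
      = \<delta> i - \<gamma> i * (((real CARD('n) - 1) / real CARD('n))\<^sup>2 * \<eta> i b
          + (\<Sum>j\<in>UNIV - {i}. \<eta> j (a j)) / (real CARD('n))\<^sup>2)"
    unfolding quadratic_contract_def
    by (simp add: integrable_squared_residual[OF noise pos]
        expected_squared_residual[OF noise pos] prob_space)
  show "utility M x w \<alpha> (quadratic_contract \<gamma> \<delta>) f i ?a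
    = \<alpha> i * (\<delta> i - \<gamma> i * ((\<Sum>j\<in>UNIV - {i}. \<eta> j (a j)) / (real CARD('n))\<^sup>2))
      - (\<alpha> i * \<gamma> i * ((real CARD('n) - 1) / real CARD('n))\<^sup>2 * \<eta> i b + f i b)"
    unfolding utility_def payment by (simp add: algebra_simps)
qed

theorem corollary2:
  fixes M :: "'s measure"
    and x :: real
    and w :: "('n::finite \<Rightarrow> real) \<Rightarrow> 'n \<Rightarrow> 's \<Rightarrow> real"
    and \<eta> \<eta>' \<eta>'' f f' f'' :: "'n \<Rightarrow> real \<Rightarrow> real"
    and \<alpha> \<gamma> \<delta> :: "'n \<Rightarrow> real"
    and a :: "'n \<Rightarrow> real"
  assumes noise: "noise_model M \<eta> w"
    and \<eta>_C2: "\<And>i. C2_on_nonneg (\<eta> i) (\<eta>' i) (\<eta>'' i)"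
    and \<eta>_nonneg: "\<And>i t. 0 \<le> t \<Longrightarrow> 0 \<le> \<eta> i t"
    and \<eta>_decreasing: "\<And>i. strict_antimono_on {0..} (\<eta> i)"
    and f_C2: "\<And>i. C2_on_nonneg (f i) (f' i) (f'' i)"
    and f_increasing: "\<And>i. strict_mono_on {0..} (f i)"
    and \<alpha>_nonneg: "\<And>i. 0 \<le> \<alpha> i"
    and \<gamma>_nonneg: "\<And>i. 0 \<le> \<gamma> i"
    and \<delta>_nonneg: "\<And>i. 0 \<le> \<delta> i"
    and first_order:
      "\<And>i. \<alpha> i * \<gamma> i * ((real CARD('n) - 1)\<^sup>2 / (real CARD('n))\<^sup>2) * \<eta>' i 0 + f' i 0 < 0"
    and second_order:
      "\<And>i t. 0 \<le> t \<Longrightarrow>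
        0 \<le> \<alpha> i * \<gamma> i * ((real CARD('n) - 1)\<^sup>2 / (real CARD('n))\<^sup>2) * \<eta>'' i t + f'' i t"
    and a_nonneg: "\<And>i. 0 \<le> a i"
  shows "contract_equilibrium (utility M x w \<alpha> (quadratic_contract \<gamma> \<delta>) f) a \<longleftrightarrow>
    a \<in> (\<Pi> i\<in>UNIV. stationary_efforts \<alpha> \<gamma> \<eta>' f' i)"
proof -
  have "is_arg_max (\<lambda>b. utility M x w \<alpha> (quadratic_contract \<gamma> \<delta>) f i (a(i := b))) (\<lambda>b. 0 \<le> b) (a i)
      \<longleftrightarrow> a i \<in> stationary_efforts \<alpha> \<gamma> \<eta>' f' i" for i
  proof -
    define k where "k = \<alpha> i * \<gamma> i * ((real CARD('n) - 1) / real CARD('n))\<^sup>2"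
    obtain K where K: "\<And>b. 0 \<le> b \<Longrightarrow>
        utility M x w \<alpha> (quadratic_contract \<gamma> \<delta>) f i (a(i := b)) = K - (k * \<eta> i b + f i b)"
      by (rule utility_of_deviation[where a = a, OF noise a_nonneg, of x \<alpha> \<gamma> \<delta> f i, folded k_def]) (rule that)
    have equilibrium_utility: "utility M x w \<alpha> (quadratic_contract \<gamma> \<delta>) f i a
        = K - (k * \<eta> i (a i) + f i (a i))"
      using K[OF a_nonneg[of i]] by simp
    have "is_arg_max (\<lambda>b. utility M x w \<alpha> (quadratic_contract \<gamma> \<delta>) f i (a(i := b))) (\<lambda>b. 0 \<le> b) (a i)
        \<longleftrightarrow> (\<forall>b\<ge>0. k * \<eta> i (a i) + f i (a i) \<le> k * \<eta> i b + f i b)"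
      using a_nonneg[of i] by (simp add: is_arg_max_def K equilibrium_utility not_less) (smt (verit))
    also have "\<dots> \<longleftrightarrow> k * \<eta>' i (a i) + f' i (a i) = 0"
    proof (rule half_line_minimizer_iff_stationary)
      fix t :: real
      assume "0 \<le> t"
      then have d: "(\<eta> i has_real_derivative \<eta>' i t) (at t within {0..})"
        "(\<eta>' i has_real_derivative \<eta>'' i t) (at t within {0..})"
        "(f i has_real_derivative f' i t) (at t within {0..})"
        "(f' i has_real_derivative f'' i t) (at t within {0..})"
        using \<eta>_C2[of i] f_C2[of i] by (auto simp: C2_on_nonneg_def)
      show "((\<lambda>b. k * \<eta> i b + f i b) has_real_derivative k * \<eta>' i t + f' i t) (at t within {0..})"
        by (intro DERIV_add DERIV_cmult d)
      show "((\<lambda>b. k * \<eta>' i b + f' i b) has_real_derivative k * \<eta>'' i t + f'' i t) (at t within {0..})"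
        by (intro DERIV_add DERIV_cmult d)
      show "0 \<le> k * \<eta>'' i t + f'' i t"
        using second_order[OF \<open>0 \<le> t\<close>, of i] by (simp add: k_def power_divide)
    next
      show "k * \<eta>' i 0 + f' i 0 < 0"
        using first_order[of i] by (simp add: k_def power_divide)
    qed (rule a_nonneg)
    also have "\<dots> \<longleftrightarrow> a i \<in> stationary_efforts \<alpha> \<gamma> \<eta>' f' i"
      using a_nonneg[of i] by (simp add: stationary_efforts_def k_def)
    finally show ?thesis .
  qed
  then show ?thesis
    by (auto simp: contract_equilibrium_def Pi_iff)
qed

end
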